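(* A simplicial complex is $1$-representable if and only if it is $1$-Matoušek.
   Context: Simplicial complexes are finite: a simplicial complex $K\subseteq 2^V$ on a finite vertex set $V=V(K)$ is a family of subsets (faces) of $V$ closed under taking subsets, containing $\emptyset$ and with $\{i\}\in K$ for every $i\in V$. Inclusion-maximal faces are called facets, and $\mathsf m_K$ denotes the set of facets of $K$. For a positive integer $d$, $K$ is $d$-representable if there are convex sets $C_i\subseteq\mathbb{R}^d$ ($i\in V$) with $K=\{I\subseteq V:\bigcap_{i\in I}C_i\neq\emptyset\}$. Dual complex: $K'=\{\alpha\subseteq \mathsf m_K:\bigcap\alpha\neq\emptyset\}$, where $\bigcap\alpha=\bigcap_{J\in\alpha}J\subseteq V$; it is a simplicial complex with vertex set $\mathsf m_K$. Geometric realization: for a simplicial complex $L$ with vertex set $W$ and $\{e_w\}_{w\in W}$ the standard basis of $\mathbb{R}^W$, $\|F\|=\mathrm{conv}\{e_w:w\in F\}$ for $F\in L$, and $\|L\|=\bigcup_{F\in L}\|F\|$. For $x\in\|L\|$, $\mathrm{supp}(x)$ is the minimal face $F\in L$ with $x\in\|F\|$. Configuration space: $\widehat K=\{(x,y)\in\|K'\|^2:\ (\bigcap\mathrm{supp}(x))\cup(\bigcap\mathrm{supp}(y))\notin K\}$, a topological subspace of $\|K'\|^2$. For a positive integer $d$, $K$ is $d$-Matoušek if there exists a continuous map $f:\widehat K\to S^{d-1}$ with $f(x,y)=-f(y,x)$ for every $(x,y)\in\widehat K$. (Here $S^0=\{-1,1\}$.) *)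

theory Defs
  imports "HOL-Analysis.Analysis" "HOL-Analysis.Finite_Function_Topology"
begin

definition finite_simplicial_complex :: "'a set \<Rightarrow> 'a set set \<Rightarrow> bool" where
  "finite_simplicial_complex V K \<longleftrightarrow>
     finite V \<and> K \<subseteq> Pow V \<and> {} \<in> K \<and> (\<forall>v\<in>V. {v} \<in> K) \<and>
     (\<forall>F\<in>K. \<forall>G. G \<subseteq> F \<longrightarrow> G \<in> K)"

definition facets :: "'a set set \<Rightarrow> 'a set set" where
  "facets K = {F \<in> K. \<forall>G\<in>K. F \<subseteq> G \<longrightarrow> G = F}"

text \<open>The dimension \<open>d\<close> is the cardinality of the index type \<open>'d\<close>, so it is automatically positive.
  The empty intersection is the whole space, hence nonempty, in accordance with \<open>{} \<in> K\<close>.\<close>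

definition representable :: "'d::finite itself \<Rightarrow> 'a set \<Rightarrow> 'a set set \<Rightarrow> bool" where
  "representable _ V K \<longleftrightarrow>
     (\<exists>C :: 'a \<Rightarrow> (real ^ 'd) set.
        (\<forall>i\<in>V. convex (C i)) \<and> K = {I. I \<subseteq> V \<and> (\<Inter>i\<in>I. C i) \<noteq> {}})"

text \<open>Here \<open>\<Inter>{} = UNIV\<close>, so that \<open>{}\<close> always is a face of the dual complex.\<close>

definition dual_complex :: "'a set set \<Rightarrow> 'a set set set" where
  "dual_complex K = {A. A \<subseteq> facets K \<and> \<Inter>A \<noteq> {}}"

text \<open>For a finite vertex set \<open>W\<close>, the space \<open>\<real>\<^sup>W\<close> is the subspace of those elements of the normed
  space of finitely supported functions \<open>'w \<Rightarrow>\<^sub>0 real\<close> that vanish outside \<open>W\<close>.  The norm of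
  that space is the \<open>\<ell>\<^sup>1\<close>-norm, which induces the Euclidean topology on \<open>\<real>\<^sup>W\<close>.\<close>

definition std_basis :: "'w \<Rightarrow> ('w \<Rightarrow>\<^sub>0 real)" where
  "std_basis w = Poly_Mapping.single w 1"

definition face_realization :: "'w set \<Rightarrow> ('w \<Rightarrow>\<^sub>0 real) set" where
  "face_realization F = convex hull (std_basis ` F)"

definition geometric_realization :: "'w set set \<Rightarrow> ('w \<Rightarrow>\<^sub>0 real) set" where
  "geometric_realization L = (\<Union>F\<in>L. face_realization F)"

text \<open>For a simplicial complex \<open>L\<close> and a point \<open>x\<close> of its realization, the minimal face whose
  realization contains \<open>x\<close> is the least one, namely the set of nonzero coordinates of \<open>x\<close>.\<close>

definition supp :: "'w set set \<Rightarrow> ('w \<Rightarrow>\<^sub>0 real) \<Rightarrow> 'w set" where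
  "supp L x = (THE F. F \<in> L \<and> x \<in> face_realization F \<and>
                 (\<forall>G\<in>L. x \<in> face_realization G \<longrightarrow> F \<subseteq> G))"

definition config_space :: "'a set set \<Rightarrow> (('a set \<Rightarrow>\<^sub>0 real) \<times> ('a set \<Rightarrow>\<^sub>0 real)) set" where
  "config_space K =
     {(x, y). x \<in> geometric_realization (dual_complex K) \<and>
              y \<in> geometric_realization (dual_complex K) \<and>
              \<Inter>(supp (dual_complex K) x) \<union> \<Inter>(supp (dual_complex K) y) \<notin> K}"

text \<open>The sphere \<open>S\<^sup>d\<^sup>-\<^sup>1\<close> is the unit sphere of \<open>real ^ 'd\<close>.\<close>

definition matousek :: "'d::finite itself \<Rightarrow> 'a set set \<Rightarrow> bool" where
  "matousek _ K \<longleftrightarrow>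
     (\<exists>f :: ('a set \<Rightarrow>\<^sub>0 real) \<times> ('a set \<Rightarrow>\<^sub>0 real) \<Rightarrow> real ^ 'd.
        continuous_on (config_space K) f \<and>
        f \<in> config_space K \<rightarrow> sphere 0 1 \<and>
        (\<forall>(x, y) \<in> config_space K. f (x, y) = - f (y, x)))"

end

theory Submission
  imports Defs
begin

text \<open>A \<open>d\<close>-representation yields points \<open>p\<^sub>J \<in> \<Inter>\<^sub>i\<^sub>\<in>\<^sub>J C\<^sub>i\<close> for the facets \<open>J\<close>; extending \<open>J \<mapsto> p\<^sub>J\<close>
  affinely to a map \<open>F\<close> on the dual complex, \<open>F x \<noteq> F y\<close> on the configuration space, and the
  normalised difference \<open>F x - F y\<close> is the required map.

  Conversely, for \<open>d = 1\<close> the signs \<open>f (e\<^sub>A, e\<^sub>B)\<close> define a tournament on the facets. If a vertex lies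
  in facets \<open>B\<close> and \<open>C\<close> but not in \<open>A\<close>, then \<open>{e\<^sub>A}\<close> times the segment from \<open>e\<^sub>B\<close> to \<open>e\<^sub>C\<close> lies in the
  configuration space, so \<open>A\<close> compares equally with \<open>B\<close> and \<open>C\<close>. In other words, the facets through a
  vertex form a module of the tournament. The tournament itself need not be transitive, but running
  quicksort on it produces a linear order in which all modules are intervals, and this
  represents the complex by intervals on the line.\<close>

section \<open>Modules of tournaments\<close>

text \<open>The diagonal is left free: \<open>T a a\<close> may be true or false.\<close>

definition tournament_on :: "'b set \<Rightarrow> ('b \<Rightarrow> 'b \<Rightarrow> bool) \<Rightarrow> bool" where
  "tournament_on X T \<longleftrightarrow> (\<forall>a\<in>X. \<forall>b\<in>X. a \<noteq> b \<longrightarrow> (T a b \<longleftrightarrow> \<not> T b a))"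

text \<open>Only arcs entering \<open>M\<close> are compared; in a tournament this determines the
  arcs leaving \<open>M\<close> as well.\<close>

definition tournament_module :: "'b set \<Rightarrow> ('b \<Rightarrow> 'b \<Rightarrow> bool) \<Rightarrow> 'b set \<Rightarrow> bool" where
  "tournament_module X T M \<longleftrightarrow> M \<subseteq> X \<and> (\<forall>b\<in>X - M. \<forall>a\<in>M. \<forall>c\<in>M. T b a \<longleftrightarrow> T b c)"

text \<open>In a tournament these are the initial unions of strongly connected components, including
  \<open>{}\<close> and \<open>X\<close>.\<close>

definition tournament_cut :: "'b set \<Rightarrow> ('b \<Rightarrow> 'b \<Rightarrow> bool) \<Rightarrow> 'b set \<Rightarrow> bool" where
  "tournament_cut X T D \<longleftrightarrow> D \<subseteq> X \<and> (\<forall>d\<in>D. \<forall>x\<in>X - D. T d x)"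

lemma tournament_moduleD:
  "tournament_module X T M \<Longrightarrow> b \<in> X \<Longrightarrow> b \<notin> M \<Longrightarrow> a \<in> M \<Longrightarrow> c \<in> M \<Longrightarrow> T b a \<longleftrightarrow> T b c"
  unfolding tournament_module_def by blast

lemma tournament_onD:
  "tournament_on X T \<Longrightarrow> a \<in> X \<Longrightarrow> b \<in> X \<Longrightarrow> a \<noteq> b \<Longrightarrow> T a b \<longleftrightarrow> \<not> T b a"
  unfolding tournament_on_def by blast

text \<open>The statement on cuts is needed for the induction: a module through the pivot meets either
  side of the pivot in a segment bounded by a cut.\<close>

lemma tournament_order_intervals_and_cuts:
  assumes "finite X" and "tournament_on X T"
  shows "\<exists>g :: 'b \<Rightarrow> nat.
    (\<forall>M. tournament_module X T M \<longrightarrow>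
       (\<forall>a\<in>M. \<forall>c\<in>M. \<forall>b\<in>X. g a \<le> g b \<and> g b \<le> g c \<longrightarrow> b \<in> M)) \<and>
    (\<forall>D. tournament_cut X T D \<longrightarrow> (\<forall>d\<in>D. \<forall>x\<in>X - D. g d < g x))"
  using assms
proof (induction X rule: finite_psubset_induct)
  case (psubset X)
  show ?case
  proof (cases "X = {}")
    case True
    then show ?thesis
      by (auto simp: tournament_cut_def)
  next
    case False
    then obtain v where v: "v \<in> X"
      by blast
    \<comment> \<open>Quicksort step with pivot \<open>v\<close>: \<open>L\<close> beats the pivot,
      \<open>R\<close> is beaten by it, and both are ordered recursively.\<close>
    define L where "L = {x \<in> X - {v}. T x v}"
    define R where "R = {x \<in> X - {v}. \<not> T x v}"
    note anti = tournament_onD[OF psubset.prems]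
    have sub: "L \<subset> X" "R \<subset> X" "v \<notin> L" "v \<notin> R" "L \<inter> R = {}" and X: "X = L \<union> {v} \<union> R"
      using v by (auto simp: L_def R_def)
    have tour: "tournament_on L T" "tournament_on R T"
      using psubset.prems sub unfolding tournament_on_def by blast+
    obtain gL :: "'b \<Rightarrow> nat" where
      gL: "\<forall>M. tournament_module L T M \<longrightarrow>
         (\<forall>a\<in>M. \<forall>c\<in>M. \<forall>b\<in>L. gL a \<le> gL b \<and> gL b \<le> gL c \<longrightarrow> b \<in> M)"
      "\<forall>D. tournament_cut L T D \<longrightarrow> (\<forall>d\<in>D. \<forall>x\<in>L - D. gL d < gL x)"
      using psubset.IH[OF sub(1) tour(1)] by (elim exE conjE)
    have gLm: "b \<in> M" if "tournament_module L T M" "a \<in> M" "c \<in> M" "b \<in> L"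
      "gL a \<le> gL b" "gL b \<le> gL c" for M a b c
      using gL(1) that by blast
    have gLc: "gL d < gL x" if "tournament_cut L T D" "d \<in> D" "x \<in> L" "x \<notin> D" for D d x
      using gL(2) that by blast
    obtain gR :: "'b \<Rightarrow> nat" where
      gR: "\<forall>M. tournament_module R T M \<longrightarrow>
         (\<forall>a\<in>M. \<forall>c\<in>M. \<forall>b\<in>R. gR a \<le> gR b \<and> gR b \<le> gR c \<longrightarrow> b \<in> M)"
      "\<forall>D. tournament_cut R T D \<longrightarrow> (\<forall>d\<in>D. \<forall>x\<in>R - D. gR d < gR x)"
      using psubset.IH[OF sub(2) tour(2)] by (elim exE conjE)
    have gRm: "b \<in> M" if "tournament_module R T M" "a \<in> M" "c \<in> M" "b \<in> R"
      "gR a \<le> gR b" "gR b \<le> gR c" for M a b c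
      using gR(1) that by blast
    have gRc: "gR d < gR x" if "tournament_cut R T D" "d \<in> D" "x \<in> R" "x \<notin> D" for D d x
      using gR(2) that by blast
    have "finite (gL ` L)"
      using psubset.hyps sub(1) by (meson finite_imageI finite_subset psubset_imp_subset)
    then obtain N where N: "\<And>x. x \<in> L \<Longrightarrow> gL x < N"
      unfolding finite_nat_set_iff_bounded by auto
    \<comment> \<open>\<open>L\<close> is placed below \<open>N\<close>, the pivot at
      \<open>N\<close>, and \<open>R\<close> strictly above; \<open>Suc\<close> separates
      \<open>R\<close> from the pivot even where \<open>gR\<close> is 0.\<close>
    define g where "g x = (if x \<in> L then gL x else if x = v then N else Suc (N + gR x))" for x
    have gL: "g x = gL x" if "x \<in> L" for x
      using that by (simp add: g_def)
    have gv: "g v = N"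
      using sub by (simp add: g_def)
    have gR: "g x = Suc (N + gR x)" if "x \<in> R" for x
      using that sub by (auto simp: g_def)
    have "b \<in> M" if M: "tournament_module X T M" and abc: "a \<in> M" "c \<in> M" "b \<in> X"
      and ord: "g a \<le> g b" "g b \<le> g c" for M a b c
    proof (rule ccontr)
      assume b: "b \<notin> M"
      have MX: "M \<subseteq> X"
        using M unfolding tournament_module_def by blast
      show False
      proof (cases "v \<in> M")
        case True
        have "b \<noteq> v"
          using b True by auto
        then consider "b \<in> L" | "b \<in> R"
          using abc X by auto
        then show False
        proof cases
          case 1
          \<comment> \<open>Elements of \<open>L - M\<close> beat \<open>v\<close>, hence by
            modularity all of \<open>M\<close>. The cut property then puts \<open>b\<close> strictly
            before \<open>a\<close>, which lies in \<open>L\<close> because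
            \<open>g a \<le> g b < N\<close>.\<close>
          have cut: "tournament_cut L T (L - M)"
            unfolding tournament_cut_def
          proof (intro conjI ballI)
            fix d x assume d: "d \<in> L - M" and x: "x \<in> L - (L - M)"
            then have "T d v \<longleftrightarrow> T d x"
              by (intro tournament_moduleD[OF M]) (use True sub in auto)
            then show "T d x"
              using d by (simp add: L_def)
          qed blast
          have "a \<in> L"
            using 1 ord(1) N[OF 1] gL[OF 1] gv gR abc MX X by fastforce
          then have "gL b < gL a"
            using gLc[OF cut, of b a] 1 b abc by auto
          then show False
            using ord(1) gL 1 \<open>a \<in> L\<close> by simp
        next
          case 2
          \<comment> \<open>Mirror image: elements of \<open>R\<close> outside \<open>M\<close> lose
            to \<open>v\<close>, hence to all of \<open>M\<close>, so \<open>c\<close> comes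
            strictly before \<open>b\<close>.\<close>
          have cut: "tournament_cut R T (R \<inter> M)"
            unfolding tournament_cut_def
          proof (intro conjI ballI)
            fix d x assume d: "d \<in> R \<inter> M" and x: "x \<in> R - R \<inter> M"
            then have "T x v \<longleftrightarrow> T x d"
              by (intro tournament_moduleD[OF M]) (use True sub in auto)
            moreover have "\<not> T x v"
              using x by (simp add: R_def)
            moreover have "T d x \<longleftrightarrow> \<not> T x d"
              using d x sub by (intro anti) auto
            ultimately show "T d x"
              by simp
          qed blast
          have "c \<in> R"
          proof (rule ccontr)
            assume "c \<notin> R"
            then have "c \<in> L \<or> c = v"
              using abc MX X by auto
            then have "g c \<le> N"
              using gL gv N by (metis less_imp_le order_refl)
            then show False
              using ord(2) gR[OF 2] by simp
          qed
          then have "gR c < gR b"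
            using gRc[OF cut, of c b] 2 b abc by auto
          then show False
            using ord(2) gR 2 \<open>c \<in> R\<close> by simp
        qed
      next
        case False
        \<comment> \<open>A pivot outside \<open>M\<close> compares equally with all of
          \<open>M\<close>, so \<open>M\<close> lies entirely in \<open>L\<close> or entirely in
          \<open>R\<close> and is a module there.\<close>
        have side: "T v x \<longleftrightarrow> T v a" if "x \<in> M" for x
          using tournament_moduleD[OF M v False that abc(1)] .
        have Lv: "x \<in> L \<longleftrightarrow> \<not> T v x" if "x \<in> M" for x
          using that False MX anti[of x v] v unfolding L_def by auto
        show False
        proof (cases "a \<in> L")
          case True
          then have inL: "M \<subseteq> L"
            using side Lv abc by blast
          then have "tournament_module L T M"
            using M sub unfolding tournament_module_def by blast
          moreover have "b \<in> L"
          proof (rule ccontr)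
            assume "b \<notin> L"
            then have "N \<le> g b"
              by (simp add: g_def)
            then show False
              using ord(2) N[of c] gL[of c] inL abc by auto
          qed
          ultimately show False
            using gLm[of M a c b] ord gL[of a] gL[of b] gL[of c]
                subsetD[OF inL abc(1)] subsetD[OF inL abc(2)] abc b by auto
        next
          case False
          then have inR: "M \<subseteq> R"
            using side Lv abc MX X \<open>v \<notin> M\<close> by blast
          then have "tournament_module R T M"
            using M sub unfolding tournament_module_def by blast
          moreover have "b \<in> R"
          proof (rule ccontr)
            assume "b \<notin> R"
            then have "b \<in> L \<or> b = v"
              using abc X by auto
            then have "g b \<le> N"
              using gL gv N by (metis less_imp_le order_refl)
            then show False
              using ord(1) gR[of a] inR abc by auto
          qed
          ultimately show False
            using gRm[of M a c b] ord gR[of a] gR[of b] gR[of c]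
                subsetD[OF inR abc(1)] subsetD[OF inR abc(2)] abc b by auto
        qed
      qed
    qed
    moreover have "g d < g x" if D: "tournament_cut X T D" and dx: "d \<in> D" "x \<in> X" "x \<notin> D" for D d x
    \<comment> \<open>If \<open>v\<close> is in \<open>D\<close>, it beats everything outside
      \<open>D\<close>, so the complement lies in \<open>R\<close>; otherwise all of
      \<open>D\<close> beats \<open>v\<close> and lies in \<open>L\<close>. Either way a cut of one
      side remains.\<close>
    proof (cases "v \<in> D")
      case True
      have "x \<in> R"
        using D dx True v anti[of x v] unfolding tournament_cut_def R_def by blast
      moreover have "tournament_cut R T (D \<inter> R)"
        using D sub unfolding tournament_cut_def by blast
      moreover have "d \<in> X"
        using D dx unfolding tournament_cut_def by blast
      ultimately show ?thesis
        using gRc[of "D \<inter> R" d x] dx gR[of x] gR[of d] gL[of d] N[of d] gv X by auto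
    next
      case False
      have "d \<in> L"
        using D dx False v unfolding tournament_cut_def L_def by blast
      moreover have "tournament_cut L T (D \<inter> L)"
        using D sub unfolding tournament_cut_def by blast
      ultimately show ?thesis
        using gLc[of "D \<inter> L" d x] dx gR[of x] gL[of x] gL[of d] N[of d] gv X by auto
    qed
    ultimately show ?thesis
      by (intro exI[of _ g]) blast
  qed
qed

text \<open>Singletons are modules, so such a \<open>g\<close> is automatically injective on
  \<open>X\<close> and gives a strict linear order.\<close>

lemma tournament_order_intervals:
  assumes "finite X" and "tournament_on X T"
  obtains g :: "'b \<Rightarrow> nat" where
    "\<And>M a b c. tournament_module X T M \<Longrightarrow> a \<in> M \<Longrightarrow> c \<in> M \<Longrightarrow> b \<in> X
       \<Longrightarrow> g a \<le> g b \<Longrightarrow> g b \<le> g c \<Longrightarrow> b \<in> M"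
  using tournament_order_intervals_and_cuts[OF assms] by meson

section \<open>Geometric realizations\<close>

lemma lookup_scaleR: "Poly_Mapping.lookup (r *\<^sub>R x) i = r *\<^sub>R Poly_Mapping.lookup x i"
  by (simp add: scaleR_poly_mapping_def)

lemma continuous_on_lookup:
  "continuous_on S (\<lambda>x :: 'w \<Rightarrow>\<^sub>0 real. Poly_Mapping.lookup x w)"
proof -
  have "bounded_linear (\<lambda>x :: 'w \<Rightarrow>\<^sub>0 real. Poly_Mapping.lookup x w)"
  proof (rule bounded_linear_intro[where K = 1])
    fix x :: "'w \<Rightarrow>\<^sub>0 real"
    have "norm (Poly_Mapping.lookup x w) \<le> (\<Sum>n\<in>Poly_Mapping.keys x. norm (Poly_Mapping.lookup x n))"
    proof (cases "w \<in> Poly_Mapping.keys x")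
      case True
      then show ?thesis
        by (intro member_le_sum) auto
    next
      case False
      then show ?thesis
        by (simp add: in_keys_iff sum_nonneg)
    qed
    then show "norm (Poly_Mapping.lookup x w) \<le> norm x * 1"
      by (simp add: norm_poly_mapping_def dist_poly_mapping_def)
  qed (auto simp: lookup_add lookup_scaleR)
  then show ?thesis
    by (rule linear_continuous_on)
qed

text \<open>Barycentric coordinates. The right-hand side is convex and contains the vertices;
  conversely its points are convex combinations of vertices with their own coordinates as weights.
  For empty \<open>F\<close> both sides are false, the empty sum being 0.\<close>

lemma face_realization_iff:
  fixes x :: "'w \<Rightarrow>\<^sub>0 real"
  assumes "finite F"
  shows "x \<in> face_realization F \<longleftrightarrow> Poly_Mapping.keys x \<subseteq> F \<and> (\<forall>w. 0 \<le> Poly_Mapping.lookup x w) \<and>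
           (\<Sum>w\<in>F. Poly_Mapping.lookup x w) = 1"
proof -
  let ?S = "{x :: 'w \<Rightarrow>\<^sub>0 real. Poly_Mapping.keys x \<subseteq> F \<and> (\<forall>w. 0 \<le> Poly_Mapping.lookup x w) \<and>
              (\<Sum>w\<in>F. Poly_Mapping.lookup x w) = 1}"
  have "std_basis w \<in> ?S" if "w \<in> F" for w
  proof -
    have "(\<Sum>u\<in>F. Poly_Mapping.lookup (std_basis w) u) = (\<Sum>u\<in>F. if u = w then 1 else 0)"
      by (rule sum.cong) (auto simp: std_basis_def lookup_single when_def)
    then show ?thesis
      using that assms by (auto simp: std_basis_def lookup_single when_def)
  qed
  moreover have "convex ?S"
  proof (rule convexI)
    fix x y :: "'w \<Rightarrow>\<^sub>0 real" and u v :: real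
    assume x: "x \<in> ?S" and y: "y \<in> ?S" and uv: "0 \<le> u" "0 \<le> v" "u + v = 1"
    have "Poly_Mapping.keys (u *\<^sub>R x + v *\<^sub>R y) \<subseteq> Poly_Mapping.keys x \<union> Poly_Mapping.keys y"
      by (auto simp: in_keys_iff lookup_add lookup_scaleR)
    moreover have "(\<Sum>w\<in>F. Poly_Mapping.lookup (u *\<^sub>R x + v *\<^sub>R y) w)
        = u * (\<Sum>w\<in>F. Poly_Mapping.lookup x w) + v * (\<Sum>w\<in>F. Poly_Mapping.lookup y w)"
      by (simp add: lookup_add lookup_scaleR sum.distrib sum_distrib_left)
    ultimately show "u *\<^sub>R x + v *\<^sub>R y \<in> ?S"
      using x y uv by (auto simp: lookup_add lookup_scaleR)
  qed
  ultimately have "face_realization F \<subseteq> ?S"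
    unfolding face_realization_def by (intro hull_minimal) auto
  moreover have "x \<in> face_realization F" if x: "x \<in> ?S" for x
  proof -
    have "(\<Sum>w\<in>F. Poly_Mapping.lookup x w *\<^sub>R std_basis w) \<in> face_realization F"
      unfolding face_realization_def
      by (rule convex_sum) (use assms x in \<open>auto simp: hull_inc\<close>)
    moreover have "(\<Sum>w\<in>F. Poly_Mapping.lookup x w *\<^sub>R std_basis w) = x"
    proof (rule poly_mapping_eqI)
      fix k
      have "Poly_Mapping.lookup (\<Sum>w\<in>F. Poly_Mapping.lookup x w *\<^sub>R std_basis w) k
          = (\<Sum>w\<in>F. if w = k then Poly_Mapping.lookup x w else 0)"
        by (simp add: lookup_sum lookup_scaleR std_basis_def lookup_single when_def if_distrib cong: if_cong)
      also have "\<dots> = Poly_Mapping.lookup x k"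
        using x assms by (auto simp: in_keys_iff)
      finally show "Poly_Mapping.lookup (\<Sum>w\<in>F. Poly_Mapping.lookup x w *\<^sub>R std_basis w) k
          = Poly_Mapping.lookup x k" .
    qed
    ultimately show ?thesis
      by simp
  qed
  ultimately show ?thesis
    by blast
qed

lemma face_realization_keys:
  assumes "finite F" and "x \<in> face_realization F"
  shows "x \<in> face_realization (Poly_Mapping.keys x)"
proof -
  have "(\<Sum>w\<in>Poly_Mapping.keys x. Poly_Mapping.lookup x w) = (\<Sum>w\<in>F. Poly_Mapping.lookup x w)"
    using assms face_realization_iff[OF assms(1), of x]
    by (intro sum.mono_neutral_left) (auto simp: in_keys_iff)
  then show ?thesis
    using assms by (simp add: face_realization_iff)
qed

text \<open>Every face whose realization contains \<open>x\<close> contains the nonzero coordinates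
  of \<open>x\<close>, and these form a face by downward closure. Hence the least face in
  \<open>supp\<close> exists and is \<open>keys x\<close>.\<close>

lemma geometric_realization_supp:
  assumes fin: "\<And>F. F \<in> L \<Longrightarrow> finite F"
    and down: "\<And>F G. F \<in> L \<Longrightarrow> G \<subseteq> F \<Longrightarrow> G \<in> L"
    and x: "x \<in> geometric_realization L"
  shows "supp L x = Poly_Mapping.keys x" and "Poly_Mapping.keys x \<in> L"
    and "Poly_Mapping.keys x \<noteq> {}" and "\<And>w. 0 \<le> Poly_Mapping.lookup x w"
    and "(\<Sum>w\<in>Poly_Mapping.keys x. Poly_Mapping.lookup x w) = 1"
proof -
  obtain F where F: "F \<in> L" "x \<in> face_realization F"
    using x by (auto simp: geometric_realization_def)
  have keys: "x \<in> face_realization (Poly_Mapping.keys x)"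
    using face_realization_keys[OF fin[OF F(1)] F(2)] .
  show L: "Poly_Mapping.keys x \<in> L"
    using down[OF F(1)] F face_realization_iff[OF fin[OF F(1)]] by blast
  show "\<And>w. 0 \<le> Poly_Mapping.lookup x w"
    and sum: "(\<Sum>w\<in>Poly_Mapping.keys x. Poly_Mapping.lookup x w) = 1"
    using keys by (auto simp: face_realization_iff)
  show "Poly_Mapping.keys x \<noteq> {}"
    using sum by auto
  have min: "Poly_Mapping.keys x \<subseteq> G" if "G \<in> L" "x \<in> face_realization G" for G
    using that face_realization_iff[OF fin[OF that(1)]] by blast
  show "supp L x = Poly_Mapping.keys x"
    unfolding supp_def
  proof (rule the_equality)
    fix G assume "G \<in> L \<and> x \<in> face_realization G \<and> (\<forall>H\<in>L. x \<in> face_realization H \<longrightarrow> G \<subseteq> H)"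
    then show "G = Poly_Mapping.keys x"
      using min L keys by blast
  qed (use L keys min in blast)
qed

section \<open>The dual complex and the configuration space\<close>

lemma finite_simplicial_complexD:
  assumes "finite_simplicial_complex V K"
  shows "finite V" "finite K" "{} \<in> K" "\<And>F. F \<in> K \<Longrightarrow> F \<subseteq> V"
    "\<And>F G. F \<in> K \<Longrightarrow> G \<subseteq> F \<Longrightarrow> G \<in> K" "finite (facets K)"
proof -
  show "finite V" and K: "finite K"
    using assms finite_subset[of K "Pow V"] by (auto simp: finite_simplicial_complex_def)
  show "finite (facets K)"
    using K by (simp add: facets_def)
qed (use assms in \<open>auto simp: finite_simplicial_complex_def\<close>)

lemma facetsD: "F \<in> facets K \<Longrightarrow> F \<in> K" "F \<in> facets K \<Longrightarrow> G \<in> K \<Longrightarrow> F \<subseteq> G \<Longrightarrow> G = F"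
  by (auto simp: facets_def)

lemma exists_facet:
  assumes "finite K" and "F \<in> K"
  obtains A where "A \<in> facets K" and "F \<subseteq> A"
proof -
  obtain A where "A \<in> K" "F \<subseteq> A" "\<forall>G\<in>K. A \<subseteq> G \<longrightarrow> A = G"
    using finite_has_maximal2[OF assms] by blast
  then show ?thesis
    using that unfolding facets_def by blast
qed

lemma finite_dual_face:
  assumes "finite (facets K)" and "F \<in> dual_complex K"
  shows "finite F"
  using assms finite_subset by (auto simp: dual_complex_def)

lemma dual_complex_down:
  assumes "F \<in> dual_complex K" and "G \<subseteq> F"
  shows "G \<in> dual_complex K"
  using assms Inter_anti_mono[of G F] by (auto simp: dual_complex_def)

lemma dual_realization_supp:
  assumes fin: "finite (facets K)" and x: "x \<in> geometric_realization (dual_complex K)"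
  shows "supp (dual_complex K) x = Poly_Mapping.keys x" "Poly_Mapping.keys x \<in> dual_complex K"
    "Poly_Mapping.keys x \<noteq> {}" "\<And>J. 0 \<le> Poly_Mapping.lookup x J"
    "(\<Sum>J\<in>Poly_Mapping.keys x. Poly_Mapping.lookup x J) = 1"
proof -
  note supp = geometric_realization_supp[of "dual_complex K", OF _ _ x]
  show "supp (dual_complex K) x = Poly_Mapping.keys x"
    by (rule supp) (fact finite_dual_face[OF fin] dual_complex_down)+
  show "Poly_Mapping.keys x \<in> dual_complex K"
    by (rule supp) (fact finite_dual_face[OF fin] dual_complex_down)+
  show "Poly_Mapping.keys x \<noteq> {}"
    by (rule supp) (fact finite_dual_face[OF fin] dual_complex_down)+
  show "\<And>J. 0 \<le> Poly_Mapping.lookup x J"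
    by (rule supp) (fact finite_dual_face[OF fin] dual_complex_down)+
  show "(\<Sum>J\<in>Poly_Mapping.keys x. Poly_Mapping.lookup x J) = 1"
    by (rule supp) (fact finite_dual_face[OF fin] dual_complex_down)+
qed

lemma config_space_iff:
  assumes "finite (facets K)"
  shows "(x, y) \<in> config_space K \<longleftrightarrow>
     x \<in> geometric_realization (dual_complex K) \<and> y \<in> geometric_realization (dual_complex K) \<and>
     \<Inter>(Poly_Mapping.keys x) \<union> \<Inter>(Poly_Mapping.keys y) \<notin> K"
  by (auto simp: config_space_def dual_realization_supp(1)[OF assms])

section \<open>Representable complexes are Matousek\<close>

lemma representable_imp_matousek:
  fixes V :: "'a set" and K :: "'a set set"
  assumes K: "finite_simplicial_complex V K" and "representable TYPE('d::finite) V K"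
  shows "matousek TYPE('d) K"
proof -
  note K = finite_simplicial_complexD[OF K]
  obtain C :: "'a \<Rightarrow> (real ^ 'd) set" where C: "\<And>i. i \<in> V \<Longrightarrow> convex (C i)"
    and KC: "K = {I. I \<subseteq> V \<and> (\<Inter>i\<in>I. C i) \<noteq> {}}"
    using assms(2) by (auto simp: representable_def)
  have "\<exists>p. \<forall>J\<in>facets K. p J \<in> (\<Inter>i\<in>J. C i)"
  proof (rule bchoice, rule ballI)
    fix J assume "J \<in> facets K"
    then have "J \<in> K"
      by (rule facetsD)
    then show "\<exists>q. q \<in> (\<Inter>i\<in>J. C i)"
      unfolding KC by blast
  qed
  then obtain p where p: "\<And>J i. J \<in> facets K \<Longrightarrow> i \<in> J \<Longrightarrow> p J \<in> C i"
    by auto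
  let ?R = "geometric_realization (dual_complex K)"
  note supp = dual_realization_supp[OF K(6)]
  \<comment> \<open>Summing over all facets, with zero weights off the support, gives one linear
    formula for all faces, so continuity is immediate.\<close>
  define F where "F x = (\<Sum>J\<in>facets K. Poly_Mapping.lookup x J *\<^sub>R p J)" for x :: "'a set \<Rightarrow>\<^sub>0 real"
  have keysV: "\<Inter>(Poly_Mapping.keys x) \<subseteq> V" and FC: "\<And>i. i \<in> \<Inter>(Poly_Mapping.keys x) \<Longrightarrow> F x \<in> C i"
    if x: "x \<in> ?R" for x
  proof -
    have sub: "Poly_Mapping.keys x \<subseteq> facets K" and ne: "Poly_Mapping.keys x \<noteq> {}"
      using supp(2,3)[OF x] by (auto simp: dual_complex_def)
    then show V: "\<Inter>(Poly_Mapping.keys x) \<subseteq> V"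
      using K(4) facetsD(1) by blast
    \<comment> \<open>Every facet \<open>J\<close> in the support contains \<open>i\<close>, so
      \<open>F x\<close> is a convex combination of points of \<open>C i\<close>.\<close>
    have "F x = (\<Sum>J\<in>Poly_Mapping.keys x. Poly_Mapping.lookup x J *\<^sub>R p J)"
      unfolding F_def using sub K(6) by (intro sum.mono_neutral_right) (auto simp: in_keys_iff)
    moreover have "(\<Sum>J\<in>Poly_Mapping.keys x. Poly_Mapping.lookup x J *\<^sub>R p J) \<in> C i"
      if i: "i \<in> \<Inter>(Poly_Mapping.keys x)" for i
    proof (rule convex_sum)
      show "convex (C i)"
        using C i V by blast
    qed (use supp(4,5)[OF x] p sub i in auto)
    ultimately show "\<And>i. i \<in> \<Inter>(Poly_Mapping.keys x) \<Longrightarrow> F x \<in> C i"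
      by simp
  qed
  have F_ne: "F x \<noteq> F y" if "(x, y) \<in> config_space K" for x y
  proof
    assume eq: "F x = F y"
    have xy: "x \<in> ?R" "y \<in> ?R"
      and "\<Inter>(Poly_Mapping.keys x) \<union> \<Inter>(Poly_Mapping.keys y) \<notin> K"
      using that by (auto simp: config_space_iff[OF K(6)])
    \<comment> \<open>A common value lies in \<open>C i\<close> for all \<open>i\<close> in the
      union, which would make the union a face.\<close>
    moreover have "F x \<in> (\<Inter>i\<in>\<Inter>(Poly_Mapping.keys x) \<union> \<Inter>(Poly_Mapping.keys y). C i)"
      using FC[OF xy(1)] FC[OF xy(2)] eq by auto
    ultimately show False
      using keysV unfolding KC by blast
  qed
  have contF: "continuous_on S F" for S
    unfolding F_def by (intro continuous_intros continuous_on_lookup)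
  have contd: "continuous_on (config_space K) (\<lambda>z. F (fst z) - F (snd z))"
    by (intro continuous_on_diff continuous_on_compose2[OF contF[of UNIV]] continuous_intros) auto
  define f where "f z = sgn (F (fst z) - F (snd z))" for z
  have "continuous_on (config_space K) f"
    unfolding f_def by (intro continuous_on_sgn contd) (use F_ne in force)
  moreover have "f \<in> config_space K \<rightarrow> sphere 0 1"
    using F_ne by (auto simp: f_def norm_sgn)
  moreover have "\<forall>(x, y) \<in> config_space K. f (x, y) = - f (y, x)"
    by (auto simp: f_def simp flip: sgn_minus)
  ultimately show ?thesis
    unfolding matousek_def by blast
qed

section \<open>Interval representations from Matousek maps\<close>

lemma keys_std_basis [simp]: "Poly_Mapping.keys (std_basis w) = {w}"
  by (simp add: std_basis_def)

text \<open>Along the segment the support is contained in \<open>{B, C}\<close>, so its intersection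
  contains \<open>B \<inter> C\<close> and hence a vertex outside \<open>A\<close>. Maximality of
  \<open>A\<close> prevents the union from being a face.\<close>

lemma config_space_segment:
  assumes K: "finite_simplicial_complex V K"
    and facets: "A \<in> facets K" "B \<in> facets K" "C \<in> facets K"
    and i: "\<not> B \<inter> C \<subseteq> A"
    and z: "z \<in> closed_segment (std_basis B) (std_basis C)"
  shows "(std_basis A, z) \<in> config_space K"
proof -
  note K = finite_simplicial_complexD[OF K]
  \<comment> \<open>An empty facet would be the only face, forcing \<open>B\<close> to be empty.
    Nonemptiness makes \<open>{A}\<close> a face of the dual complex.\<close>
  have "A \<noteq> {}"
    using facetsD(2)[OF facets(1) facetsD(1)[OF facets(2)]] i by blast
  then have dual: "{A} \<in> dual_complex K" "{B, C} \<in> dual_complex K"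
    using facets i by (auto simp: dual_complex_def)
  have z': "z \<in> face_realization {B, C}"
    using z by (simp add: face_realization_def segment_convex_hull)
  then have R: "z \<in> geometric_realization (dual_complex K)"
    using dual by (auto simp: geometric_realization_def)
  have "Poly_Mapping.keys z \<subseteq> {B, C}"
    using z' by (simp add: face_realization_iff)
  then have "B \<inter> C \<subseteq> \<Inter>(Poly_Mapping.keys z)"
    by blast
  then have "A \<union> \<Inter>(Poly_Mapping.keys z) \<notin> K"
    using facetsD(2)[OF facets(1), of "A \<union> \<Inter>(Poly_Mapping.keys z)"] i by blast
  moreover have "std_basis A \<in> geometric_realization (dual_complex K)"
    using dual(1) by (auto simp: geometric_realization_def face_realization_def intro!: bexI[of _ "{A}"])
  ultimately show ?thesis
    using R by (auto simp: config_space_iff[OF K(6)])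
qed

text \<open>The sphere in dimension one consists of two points, and a connected subset of a finite
  set has at most one point.\<close>

lemma continuous_sphere_real1_constant:
  fixes f :: "'b::topological_space \<Rightarrow> real ^ 1"
  assumes "continuous_on S f" and "f ` S \<subseteq> sphere 0 1" and "connected S" and "x \<in> S" and "y \<in> S"
  shows "f x = f y"
proof -
  have "sphere 0 1 \<subseteq> {1, - 1 :: real ^ 1}"
    by (auto simp: norm_real vec_eq_iff)
  then have "finite (f ` S)"
    using assms(2) by (meson finite.emptyI finite.insertI finite_subset)
  moreover have "connected (f ` S)"
    using assms by (intro connected_continuous_image)
  ultimately show ?thesis
    using connected_finite_iff_sing[of "f ` S"] assms(4,5) by (metis empty_iff imageI singletonD)
qed

lemma matousek_imp_representable:
  fixes V :: "'a set" and K :: "'a set set"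
  assumes complex: "finite_simplicial_complex V K" and "matousek TYPE(1) K"
  shows "representable TYPE(1) V K"
proof -
  note K = finite_simplicial_complexD[OF complex]
  obtain f :: "('a set \<Rightarrow>\<^sub>0 real) \<times> ('a set \<Rightarrow>\<^sub>0 real) \<Rightarrow> real ^ 1" where
    cont: "continuous_on (config_space K) f" and sph: "f ` config_space K \<subseteq> sphere 0 1" and
    odd: "\<And>x y. (x, y) \<in> config_space K \<Longrightarrow> f (x, y) = - f (y, x)"
    using assms(2) unfolding matousek_def by fast
  define T where "T A B \<longleftrightarrow> f (std_basis A, std_basis B) $ 1 > 0" for A B
  have tour: "tournament_on (facets K) T"
    unfolding tournament_on_def
  proof (intro ballI impI)
    fix A B assume AB: "A \<in> facets K" "B \<in> facets K" "A \<noteq> B"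
    then have "\<not> A \<subseteq> B" "\<not> B \<subseteq> A"
      using facetsD by metis+
    \<comment> \<open>The degenerate segment with \<open>C = B\<close> yields the pair of
      vertices.\<close>
    then have "(std_basis A, std_basis B) \<in> config_space K"
      using config_space_segment[OF complex AB(1) AB(2) AB(2), of "std_basis B"] by auto
    then have "f (std_basis A, std_basis B) = - f (std_basis B, std_basis A)"
      and "norm (f (std_basis A, std_basis B)) = 1"
      using odd sph by (auto simp: image_subset_iff)
    then show "T A B \<longleftrightarrow> \<not> T B A"
      by (auto simp: T_def norm_real)
  qed
  define S where "S i = {A \<in> facets K. i \<in> A}" for i
  have mod: "tournament_module (facets K) T (S i)" for i
    unfolding tournament_module_def
  proof (intro conjI ballI)
    fix A B C assume A: "A \<in> facets K - S i" and BC: "B \<in> S i" "C \<in> S i"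
    let ?P = "{std_basis A} \<times> closed_segment (std_basis B) (std_basis C)"
    have sub: "?P \<subseteq> config_space K"
      using config_space_segment[OF complex, of A B C] A BC by (auto simp: S_def)
    have "f (std_basis A, std_basis B) = f (std_basis A, std_basis C)"
    proof (rule continuous_sphere_real1_constant[of ?P])
      show "continuous_on ?P f"
        using cont sub by (rule continuous_on_subset)
      show "connected ?P"
        by (intro connected_Times) auto
    qed (use sub sph in auto)
    then show "T A B \<longleftrightarrow> T A C"
      by (simp add: T_def)
  qed (auto simp: S_def)
  obtain g :: "'a set \<Rightarrow> nat" where
    g: "\<And>M a b c. tournament_module (facets K) T M \<Longrightarrow> a \<in> M \<Longrightarrow> c \<in> M \<Longrightarrow> b \<in> facets K
          \<Longrightarrow> g a \<le> g b \<Longrightarrow> g b \<le> g c \<Longrightarrow> b \<in> M"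
    using tournament_order_intervals[OF K(6) tour] by metis
  \<comment> \<open>The interval spanned by the positions of the facets through \<open>i\<close>;
    witnesses in place of minimum and maximum also cover an empty \<open>S i\<close>.\<close>
  define C :: "'a \<Rightarrow> (real ^ 1) set" where
    "C i = {x. \<exists>A\<in>S i. \<exists>B\<in>S i. real (g A) \<le> x $ 1 \<and> x $ 1 \<le> real (g B)}" for i
  have "convex (C i)" for i
  proof -
    have "is_interval (C i)"
      unfolding is_interval_def
    proof (intro ballI allI impI)
      fix a b x :: "real ^ 1"
      assume "a \<in> C i" "b \<in> C i"
      then obtain A B A' B' where S: "A \<in> S i" "B \<in> S i" "A' \<in> S i" "B' \<in> S i"
        and "real (g A) \<le> a $ 1" "a $ 1 \<le> real (g B)" "real (g A') \<le> b $ 1" "b $ 1 \<le> real (g B')"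
        unfolding C_def by blast
      moreover assume x: "\<forall>j\<in>Basis. a \<bullet> j \<le> x \<bullet> j \<and> x \<bullet> j \<le> b \<bullet> j \<or> b \<bullet> j \<le> x \<bullet> j \<and> x \<bullet> j \<le> a \<bullet> j"
      moreover have "a $ 1 \<le> x $ 1 \<and> x $ 1 \<le> b $ 1 \<or> b $ 1 \<le> x $ 1 \<and> x $ 1 \<le> a $ 1"
        using x[rule_format, of "axis 1 1"] by (simp add: inner_axis)
      ultimately have "real (g A) \<le> x $ 1 \<and> x $ 1 \<le> real (g B') \<or>
          real (g A') \<le> x $ 1 \<and> x $ 1 \<le> real (g B)"
        by linarith
      with S show "x \<in> C i"
        unfolding C_def by blast
    qed
    then show ?thesis
      by (rule is_interval_convex)
  qed
  moreover have "K = {I. I \<subseteq> V \<and> (\<Inter>i\<in>I. C i) \<noteq> {}}"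
  proof (intro equalityI subsetI)
    fix I assume I: "I \<in> K"
    then obtain A where A: "A \<in> facets K" "I \<subseteq> A"
      using exists_facet K(2) by metis
    \<comment> \<open>For \<open>i \<in> I\<close> the facet \<open>A\<close> lies in
      \<open>S i\<close> and serves as both the lower and the upper bound.\<close>
    then have "vec (real (g A)) \<in> (\<Inter>i\<in>I. C i)"
      by (auto simp: C_def S_def)
    then show "I \<in> {I. I \<subseteq> V \<and> (\<Inter>i\<in>I. C i) \<noteq> {}}"
      using K(4)[OF I] by blast
  next
    fix I assume "I \<in> {I. I \<subseteq> V \<and> (\<Inter>i\<in>I. C i) \<noteq> {}}"
    then obtain x where IV: "I \<subseteq> V" and x: "\<And>i. i \<in> I \<Longrightarrow> x \<in> C i"
      by blast
    show "I \<in> K"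
    proof (cases "I = {}")
      case True
      then show ?thesis
        using K(3) by simp
    next
      case False
      have finI: "finite I"
        using IV K(1) finite_subset by blast
      \<comment> \<open>Among the facets bounding \<open>x\<close> from below choose, for each vertex of \<open>I\<close>, one; the
        rightmost of these lies in every interval.\<close>
      have "\<exists>l. \<forall>i\<in>I. l i \<in> S i \<and> real (g (l i)) \<le> x $ 1"
        by (rule bchoice) (use x in \<open>auto simp: C_def\<close>)
      then obtain l where l: "\<And>i. i \<in> I \<Longrightarrow> l i \<in> S i" "\<And>i. i \<in> I \<Longrightarrow> real (g (l i)) \<le> x $ 1"
        by blast
      obtain k where k: "k \<in> I" "\<And>i. i \<in> I \<Longrightarrow> g (l i) \<le> g (l k)"
        using obtains_MAX[OF finI False, of "\<lambda>i. g (l i)"] finI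
        by (metis Max_ge finite_imageI imageI)
      \<comment> \<open>In the order, \<open>l k\<close> lies between \<open>l i\<close> and a facet
        \<open>B\<close> through \<open>i\<close> bounding \<open>x\<close> from above; the module
        \<open>S i\<close> is an interval, so it contains \<open>l k\<close>.\<close>
      have "l k \<in> S i" if i: "i \<in> I" for i
      proof -
        obtain B where B: "B \<in> S i" "x $ 1 \<le> real (g B)"
          using x[OF i] by (auto simp: C_def)
        have "g (l k) \<le> g B"
          using l(2)[OF k(1)] B(2) by linarith
        then show ?thesis
          using g[OF mod l(1)[OF i] B(1)] k(2)[OF i] l(1)[OF k(1)] by (auto simp: S_def)
      qed
      then have "I \<subseteq> l k" "l k \<in> K"
        using l(1)[OF k(1)] facetsD(1) by (auto simp: S_def)
      then show ?thesis
        using K(5) by blast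
    qed
  qed
  ultimately show ?thesis
    unfolding representable_def by (intro exI[of _ C] conjI ballI)
qed

theorem theorem4p4:
  fixes V :: "'a set" and K :: "'a set set"
  assumes "finite_simplicial_complex V K"
  shows "representable TYPE(1) V K \<longleftrightarrow> matousek TYPE(1) K"
  using representable_imp_matousek[OF assms] matousek_imp_representable[OF assms] by blast

end
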